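(* Let $G$ be a graph on $n$ vertices, let $h,k$ be integers with $1\le h\le k\le\frac n2$, let $B$ be the $(n;k,h)$-binomial matrix, and let $L_h$ and $L_k$ be the Laplacian matrices of the token graphs $F_h(G)$ and $F_k(G)$. Then: (i) If $v$ is a $\lambda$-eigenvector of $L_h$, then $Bv$ is a $\lambda$-eigenvector of $L_k$. Moreover, linear independence of eigenvectors is preserved: if $v_1,\dots,v_r$ are linearly independent eigenvectors of $L_h$, then $Bv_1,\dots,Bv_r$ are linearly independent. (That is, the spectrum of $L_h$ is contained, with multiplicities, in the spectrum of $L_k$.) (ii) If $w$ is a $\lambda$-eigenvector of $L_k$ and $B^{\top}w\neq 0$, then $B^{\top}w$ is a $\lambda$-eigenvector of $L_h$. Moreover, all the eigenvalues of $L_h$, including multiplicities, are obtained in this way: for every eigenvalue $\lambda$ of $L_h$ of multiplicity $m$, there are $m$ $\lambda$-eigenvectors $w_1,\dots,w_m$ of $L_k$ such that $B^{\top}w_1,\dots,B^{\top}w_m$ are linearly independent.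
   Context: All graphs are finite and simple. For a graph $G$ with vertex set $[n]=\{1,\dots,n\}$ and $1\le k\le n$, the $k$-token graph $F_k(G)$ has as vertices the $k$-subsets of $[n]$; two vertices $A,B$ are adjacent iff $A\bigtriangleup B=\{a,b\}$ with $a\in A$, $b\in B$ and $\{a,b\}$ an edge of $G$. The Laplacian matrix of a graph is the diagonal degree matrix minus the adjacency matrix. The $(n;k,h)$-binomial matrix $B$ is the $\binom nk\times\binom nh$ $(0,1)$-matrix with rows indexed by the $k$-subsets $A\subseteq[n]$ and columns indexed by the $h$-subsets $X\subseteq[n]$, with $B_{AX}=1$ if $X\subseteq A$ and $B_{AX}=0$ otherwise. A $\lambda$-eigenvector is a nonzero eigenvector with eigenvalue $\lambda$. The same orderings of subsets are used for $B$, $L_h$, $L_k$. *)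

theory Defs
  imports
    "Graph_Theory.Pair_Digraph"
    "Jordan_Normal_Form.Char_Poly"
    "Jordan_Normal_Form.VS_Connect"
begin

(* A finite simple graph is a pair_graph: a finite, loop-free digraph whose arc set is symmetric,
   so that the edge {a, b} is represented by the two arcs (a, b) and (b, a). *)

definition k_subsets :: "'a set \<Rightarrow> nat \<Rightarrow> 'a set set" where
  "k_subsets V k = {A. A \<subseteq> V \<and> card A = k}"

definition token_graph :: "nat \<Rightarrow> 'a pair_pre_digraph \<Rightarrow> 'a set pair_pre_digraph" where
  "token_graph k G =
     \<lparr> pverts = k_subsets (pverts G) k,
       parcs = {(A, B). A \<in> k_subsets (pverts G) k \<and> B \<in> k_subsets (pverts G) k \<and>
                  (\<exists>a\<in>A. \<exists>b\<in>B. sym_diff A B = {a, b} \<and> (a, b) \<in> parcs G)} \<rparr>"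

lemma pair_graph_token_graph:
  assumes "pair_graph G"
  shows "pair_graph (token_graph k G)"
proof -
  interpret pair_graph G by fact
  have fin: "finite (k_subsets (pverts G) k)"
    unfolding k_subsets_def by simp
  have "(b, a) \<in> parcs G" if "(a, b) \<in> parcs G" for a b
    using that sym_arcs by (auto simp: symmetric_def dest: symD)
  note parcs_swap = this
  have "(B, A) \<in> parcs (token_graph k G)" if AB: "(A, B) \<in> parcs (token_graph k G)" for A B
  proof -
    from AB obtain a b where *: "A \<in> k_subsets (pverts G) k" "B \<in> k_subsets (pverts G) k"
        "a \<in> A" "b \<in> B" "sym_diff A B = {a, b}" "(a, b) \<in> parcs G"
      unfolding token_graph_def by auto
    have "sym_diff B A = {b, a}"
      using *(5) by (simp add: Un_commute insert_commute)
    with * parcs_swap[OF *(6)] show ?thesis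
      unfolding token_graph_def pair_pre_digraph.simps mem_Collect_eq prod.case by blast
  qed
  hence "sym (parcs (token_graph k G))"
    by (rule symI)
  hence symm: "symmetric (with_proj (token_graph k G))"
    by (simp add: symmetric_def)
  have fin_arcs: "finite (parcs (token_graph k G))"
    by (rule finite_subset[of _ "k_subsets (pverts G) k \<times> k_subsets (pverts G) k"])
       (auto simp: token_graph_def fin)
  have sub: "parcs (token_graph k G) \<subseteq>
      pverts (token_graph k G) \<times> pverts (token_graph k G)"
    unfolding token_graph_def by auto
  have irr: "A \<noteq> B" if "(A, B) \<in> parcs (token_graph k G)" for A B
    using that unfolding token_graph_def by auto
  have wf: "fst e \<in> pverts (token_graph k G)" "snd e \<in> pverts (token_graph k G)"
    "fst e \<noteq> snd e" if "e \<in> parcs (token_graph k G)" for e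
    using subsetD[OF sub that] irr[of "fst e" "snd e"] that by (simp_all add: mem_Times_iff)
  have fin_verts: "finite (pverts (token_graph k G))"
    using fin by (simp add: token_graph_def)
  show ?thesis
    by unfold_locales (fact wf fin_verts fin_arcs symm)+
qed

(* Matrices are indexed by positions in a list that enumerates the index set without repetition;
   this list is the chosen ordering of rows or columns. *)

definition is_ordering :: "'a list \<Rightarrow> 'a set \<Rightarrow> bool" where
  "is_ordering xs S \<longleftrightarrow> distinct xs \<and> set xs = S"

definition adjacency_matrix :: "'a list \<Rightarrow> 'a pair_pre_digraph \<Rightarrow> real mat" where
  "adjacency_matrix xs G =
     mat (length xs) (length xs) (\<lambda>(i, j). if (xs ! i, xs ! j) \<in> parcs G then 1 else 0)"

(* Each edge at v contributes exactly one outgoing arc, so the out-degree is the graph degree. *)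
definition degree_matrix :: "'a list \<Rightarrow> 'a pair_pre_digraph \<Rightarrow> real mat" where
  "degree_matrix xs G =
     mat (length xs) (length xs)
       (\<lambda>(i, j). if i = j then real (out_degree (with_proj G) (xs ! i)) else 0)"

definition laplacian_matrix :: "'a list \<Rightarrow> 'a pair_pre_digraph \<Rightarrow> real mat" where
  "laplacian_matrix xs G = degree_matrix xs G - adjacency_matrix xs G"

(* xs orders the k-subsets (rows) and ys the h-subsets (columns). *)
definition binomial_matrix :: "'a set list \<Rightarrow> 'a set list \<Rightarrow> real mat" where
  "binomial_matrix xs ys =
     mat (length xs) (length ys) (\<lambda>(i, j). if ys ! j \<subseteq> xs ! i then 1 else 0)"

(* Independence of the family of list entries: a repeated vector makes the family dependent,
   whereas lin_dep only sees the underlying set. *)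
definition lin_indpt_family :: "nat \<Rightarrow> real vec list \<Rightarrow> bool" where
  "lin_indpt_family d vs \<longleftrightarrow>
     set vs \<subseteq> carrier_vec d \<and> distinct vs \<and>
     \<not> module.lin_dep class_ring (module_vec TYPE(real) d) (set vs)"

end

theory Submission
  imports Defs
    "HOL-Combinatorics.Transposition"
    "Jordan_Normal_Form.DL_Rank"
    "Jordan_Normal_Form.Jordan_Normal_Form_Existence"
    "Jordan_Normal_Form.Jordan_Normal_Form_Uniqueness"
begin

text \<open>Up to the factor 2, the Laplacian of every token graph is the sum over the arcs \<open>(a, b)\<close> of \<open>G\<close>
  of \<open>I\<close> minus the permutation action of the transposition \<open>(a b)\<close> on subsets. Inclusion of sets is
  invariant under permutations, so \<open>L\<^sub>k B = B L\<^sub>h\<close> and, transposing, \<open>L\<^sub>h B\<^sup>T = B\<^sup>T L\<^sub>k\<close>.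
  Moreover \<open>B\<close> is injective when \<open>h \<le> k \<le> n - h\<close>, hence so is \<open>B\<^sup>T B\<close>, and the vectors
  \<open>w\<^sub>i\<close> of part (ii) can be taken to be \<open>B v\<^sub>i\<close> for a basis \<open>v\<^sub>i\<close> of an eigenspace of \<open>L\<^sub>h\<close>.
  Algebraic multiplicities are dimensions of eigenspaces because the Laplacians are symmetric.\<close>

section \<open>Injectivity of the inclusion sums over subsets\<close>

lemma finite_k_subsets: "finite V \<Longrightarrow> finite (k_subsets V k)"
  unfolding k_subsets_def by simp

lemma card_k_subsets: "finite V \<Longrightarrow> card (k_subsets V k) = card V choose k"
  unfolding k_subsets_def by (rule n_subsets)

text \<open>Double counting over \<open>A\<close> with one element removed passes from one size to
  the next. Sets larger than \<open>k\<close> are needed because inclusion-exclusion below runs over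
  complements \<open>V - T\<close> of varying size.\<close>

lemma subset_sums_zero_upward:
  fixes v :: "'a set \<Rightarrow> real"
  assumes V: "finite V" and "h \<le> k"
    and zero: "\<And>A. A \<in> k_subsets V k \<Longrightarrow> (\<Sum>X\<in>k_subsets A h. v X) = 0"
    and "A \<subseteq> V" "k \<le> card A"
  shows "(\<Sum>X\<in>k_subsets A h. v X) = 0"
  using assms(4,5)
proof (induction "card A - k" arbitrary: A)
  case 0
  thus ?case by (intro zero) (simp add: k_subsets_def)
next
  case (Suc d)
  have fin: "finite A" using Suc.prems(1) V by (rule finite_subset)
  have IH: "(\<Sum>X\<in>k_subsets (A - {a}) h. v X) = 0" if "a \<in> A" for a
    using Suc.hyps(2) Suc.prems that fin by (intro Suc.hyps(1)) (auto simp: card_Diff_singleton_if)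
  \<comment> \<open>Each \<open>X\<close> is counted once for every \<open>a \<in> A - X\<close>, and there are \<open>card A - h > 0\<close> of these.\<close>
  have "0 = (\<Sum>a\<in>A. \<Sum>X\<in>k_subsets (A - {a}) h. v X)"
    by (simp add: IH)
  also have "\<dots> = (\<Sum>a\<in>A. \<Sum>X\<in>k_subsets A h. if a \<notin> X then v X else 0)"
  proof (rule sum.cong[OF refl])
    fix a
    have "k_subsets (A - {a}) h = {X \<in> k_subsets A h. a \<notin> X}"
      unfolding k_subsets_def by auto
    thus "(\<Sum>X\<in>k_subsets (A - {a}) h. v X) = (\<Sum>X\<in>k_subsets A h. if a \<notin> X then v X else 0)"
      using fin by (simp add: sum.inter_filter finite_k_subsets)
  qed
  also have "\<dots> = (\<Sum>X\<in>k_subsets A h. \<Sum>a\<in>A. if a \<notin> X then v X else 0)"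
    by (rule sum.swap)
  also have "\<dots> = (\<Sum>X\<in>k_subsets A h. real (card A - h) * v X)"
  proof (rule sum.cong[OF refl])
    fix X assume "X \<in> k_subsets A h"
    hence X: "X \<subseteq> A" "card X = h" unfolding k_subsets_def by auto
    have "{a \<in> A. a \<notin> X} = A - X" by auto
    hence "card {a \<in> A. a \<notin> X} = card A - h"
      using X fin by (simp add: card_Diff_subset finite_subset)
    thus "(\<Sum>a\<in>A. if a \<notin> X then v X else 0) = real (card A - h) * v X"
      using fin by (simp flip: sum.inter_filter)
  qed
  also have "\<dots> = real (card A - h) * (\<Sum>X\<in>k_subsets A h. v X)"
    by (simp add: sum_distrib_left)
  finally show ?case
    using Suc.hyps(2) \<open>h \<le> k\<close> by auto
qed

text \<open>The value \<open>v X\<close> is the sum over all \<open>h\<close>-subsets containing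
  \<open>X\<close>. Inclusion-exclusion reduces it to sums over the \<open>h\<close>-subsets of
  \<open>V - T\<close> with \<open>T \<subseteq> X\<close>; such a set has at least
  \<open>card V - h \<ge> k\<close> elements, so these sums vanish.\<close>

lemma subset_sums_injective:
  fixes v :: "'a set \<Rightarrow> real"
  assumes V: "finite V" and "h \<le> k" and hk: "h + k \<le> card V"
    and zero: "\<And>A. A \<in> k_subsets V k \<Longrightarrow> (\<Sum>X\<in>k_subsets A h. v X) = 0"
    and X: "X \<in> k_subsets V h"
  shows "v X = 0"
proof -
  \<comment> \<open>Inclusion-exclusion: the condition \<open>S \<subseteq> X\<close> is imposed one element at a time,
    each time as a difference of two sums without that condition.\<close>
  have *: "(\<Sum>X\<in>{X \<in> k_subsets (V - T) h. S \<subseteq> X}. v X) = 0"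
    if "finite S" "S \<subseteq> V" "T \<subseteq> V" "S \<inter> T = {}" "card S + card T + k \<le> card V" for S T
    using that
  proof (induction S arbitrary: T rule: finite_induct)
    case empty
    have "card (V - T) = card V - card T"
      using empty V by (meson card_Diff_subset finite_subset)
    thus ?case
      using empty by (auto intro!: subset_sums_zero_upward[OF V \<open>h \<le> k\<close> zero])
  next
    case (insert x S)
    have finT: "finite T" using insert.prems V by (auto intro: finite_subset)
    \<comment> \<open>The split is by whether \<open>x\<close> lies in the set. Moving
      \<open>x\<close> from the required elements to the forbidden ones keeps the total number, so
      the size bound survives.\<close>
    have eq: "{X \<in> k_subsets (V - T) h. S \<subseteq> X} =
        {X \<in> k_subsets (V - T) h. insert x S \<subseteq> X} \<union>
        {X \<in> k_subsets (V - insert x T) h. S \<subseteq> X}"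
      unfolding k_subsets_def by auto
    have "(\<Sum>X\<in>{X \<in> k_subsets (V - T) h. S \<subseteq> X}. v X) =
        (\<Sum>X\<in>{X \<in> k_subsets (V - T) h. insert x S \<subseteq> X}. v X) +
        (\<Sum>X\<in>{X \<in> k_subsets (V - insert x T) h. S \<subseteq> X}. v X)"
      unfolding eq using V by (intro sum.union_disjoint) (auto simp: finite_k_subsets k_subsets_def)
    moreover have "(\<Sum>X\<in>{X \<in> k_subsets (V - T) h. S \<subseteq> X}. v X) = 0"
      using insert by (intro insert.IH) auto
    moreover have "(\<Sum>X\<in>{X \<in> k_subsets (V - insert x T) h. S \<subseteq> X}. v X) = 0"
      using insert finT by (intro insert.IH) (auto simp: card_insert_if)
    ultimately show ?case by simp
  qed
  \<comment> \<open>For \<open>S = X\<close> and \<open>T = {}\<close> the sum has the single term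
    \<open>v X\<close>.\<close>
  have "Y = X" if "Y \<in> k_subsets V h" "X \<subseteq> Y" for Y
    using that X V card_subset_eq[of Y X] unfolding k_subsets_def by (auto intro: finite_subset)
  hence "{Y \<in> k_subsets (V - {}) h. X \<subseteq> Y} = {X}"
    using X by auto
  moreover have "(\<Sum>Y\<in>{Y \<in> k_subsets (V - {}) h. X \<subseteq> Y}. v Y) = 0"
    using X V hk by (intro *) (auto simp: k_subsets_def dest: finite_subset)
  ultimately show ?thesis by simp
qed

section \<open>Token graph Laplacians as sums over transpositions\<close>

lemma transpose_image_exchange:
  assumes "a \<in> A" "b \<notin> A"
  shows "Transposition.transpose a b ` A = insert b (A - {a})"
  using assms by (auto simp: in_transpose_image_iff Transposition.transpose_def split: if_splits)

text \<open>A neighbour of \<open>A\<close> arises by moving one token along an arc leaving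
  \<open>A\<close>, and the symmetric difference determines that arc. Sums over neighbours thus
  become sums over arcs of \<open>G\<close>.\<close>

lemma bij_betw_token_neighbours:
  assumes "pair_graph G" and A: "A \<in> k_subsets (pverts G) k"
  shows "bij_betw (\<lambda>(a, b). Transposition.transpose a b ` A)
    {(a, b) \<in> parcs G. a \<in> A \<and> b \<notin> A} {B. (A, B) \<in> parcs (token_graph k G)}"
proof -
  interpret pair_graph G by fact
  have fin: "finite A"
    using A finite_verts unfolding k_subsets_def by (auto intro: finite_subset)
  have "inj_on (\<lambda>(a, b). Transposition.transpose a b ` A) {(a, b) \<in> parcs G. a \<in> A \<and> b \<notin> A}"
  proof (rule inj_onI, clarsimp)
    fix a b c d
    assume "a \<in> A" "b \<notin> A" "c \<in> A" "d \<notin> A"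
      and "Transposition.transpose a b ` A = Transposition.transpose c d ` A"
    hence "insert b (A - {a}) = insert d (A - {c})"
      by (simp add: transpose_image_exchange)
    hence "x = b \<or> x \<in> A \<and> x \<noteq> a \<longleftrightarrow> x = d \<or> x \<in> A \<and> x \<noteq> c" for x
      by (auto simp: set_eq_iff)
    \<comment> \<open>Membership of \<open>a\<close> forces \<open>a = c\<close>, membership of
      \<open>b\<close> forces \<open>b = d\<close>.\<close>
    from this[of a] this[of b] show "a = c \<and> b = d"
      using \<open>a \<in> A\<close> \<open>b \<notin> A\<close> \<open>c \<in> A\<close> \<open>d \<notin> A\<close> by metis
  qed
  moreover have "(\<lambda>(a, b). Transposition.transpose a b ` A) ` {(a, b) \<in> parcs G. a \<in> A \<and> b \<notin> A} =
      {B. (A, B) \<in> parcs (token_graph k G)}"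
  proof (intro equalityI subsetI; clarsimp)
    fix a b assume ab: "(a, b) \<in> parcs G" "a \<in> A" "b \<notin> A"
    have "b \<in> pverts G" using ab(1) by (rule in_arcsD2)
    hence "insert b (A - {a}) \<in> k_subsets (pverts G) k"
      using A ab fin card_Suc_Diff1[of A a] unfolding k_subsets_def by (auto simp: card_insert_if)
    moreover have "sym_diff A (insert b (A - {a})) = {a, b}"
      using ab by auto
    ultimately show "(A, Transposition.transpose a b ` A) \<in> parcs (token_graph k G)"
      using A ab unfolding transpose_image_exchange[OF ab(2,3)] token_graph_def by auto
  next
    fix B assume "(A, B) \<in> parcs (token_graph k G)"
    then obtain a b where ab: "a \<in> A" "b \<in> B" "sym_diff A B = {a, b}" "(a, b) \<in> parcs G"
      unfolding token_graph_def by auto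
    have "a \<noteq> b" using ab(4) no_loops' by auto
    hence "b \<notin> A" "B = insert b (A - {a})"
      using ab by auto
    hence "B = Transposition.transpose a b ` A"
      using ab by (simp add: transpose_image_exchange)
    thus "B \<in> (\<lambda>(a, b). Transposition.transpose a b ` A) ` {(a, b). (a, b) \<in> parcs G \<and> a \<in> A \<and> b \<notin> A}"
      using ab \<open>b \<notin> A\<close> by force
  qed
  ultimately show ?thesis
    unfolding bij_betw_def by simp
qed

text \<open>Arcs not separated by \<open>A\<close> contribute 0 to the right-hand side, and the separated ones
  occur once in each direction, hence the division by 2.\<close>

lemma token_laplacian_eq_sum_transpositions:
  fixes F :: "'a set \<Rightarrow> real"
  assumes G: "pair_graph G" and A: "A \<in> k_subsets (pverts G) k"
  shows "real (out_degree (with_proj (token_graph k G)) A) * F A -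
      (\<Sum>B\<in>k_subsets (pverts G) k. if (A, B) \<in> parcs (token_graph k G) then F B else 0) =
    (\<Sum>(a, b)\<in>parcs G. F A - F (Transposition.transpose a b ` A)) / 2"
proof -
  interpret pair_graph G by fact
  define N where "N = {B. (A, B) \<in> parcs (token_graph k G)}"
  define S where "S = {(a, b) \<in> parcs G. a \<in> A \<and> b \<notin> A}"
  define S' where "S' = {(a, b) \<in> parcs G. a \<notin> A \<and> b \<in> A}"
  have fin: "finite (k_subsets (pverts G) k)"
    by (simp add: finite_k_subsets)
  have N: "N = {B \<in> k_subsets (pverts G) k. (A, B) \<in> parcs (token_graph k G)}"
    unfolding N_def token_graph_def by auto
  have "out_arcs (with_proj (token_graph k G)) A = Pair A ` N"
    unfolding out_arcs_def N_def by auto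
  hence deg: "out_degree (with_proj (token_graph k G)) A = card N"
    unfolding out_degree_def by (simp add: card_image inj_on_def)
  have "real (out_degree (with_proj (token_graph k G)) A) * F A -
      (\<Sum>B\<in>k_subsets (pverts G) k. if (A, B) \<in> parcs (token_graph k G) then F B else 0) =
      (\<Sum>B\<in>N. F A - F B)"
    unfolding deg using fin by (simp add: N sum.inter_filter sum_subtractf)
  also have "\<dots> = (\<Sum>(a, b)\<in>S. F A - F (Transposition.transpose a b ` A))"
    using sum.reindex_bij_betw[OF bij_betw_token_neighbours[OF G A], of "\<lambda>B. F A - F B"]
    unfolding N_def S_def by (simp add: case_prod_beta)
  finally have 1: "real (out_degree (with_proj (token_graph k G)) A) * F A -
      (\<Sum>B\<in>k_subsets (pverts G) k. if (A, B) \<in> parcs (token_graph k G) then F B else 0) =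
      (\<Sum>(a, b)\<in>S. F A - F (Transposition.transpose a b ` A))" .
  have arc_swap: "(b, a) \<in> parcs G" if "(a, b) \<in> parcs G" for a b
    using that sym_arcs by (auto simp: symmetric_def dest: symD)
  have "bij_betw prod.swap S S'"
    unfolding bij_betw_def S_def S'_def by (auto intro: arc_swap simp: image_iff)
  hence "(\<Sum>(a, b)\<in>S. F A - F (Transposition.transpose b a ` A)) =
      (\<Sum>(a, b)\<in>S'. F A - F (Transposition.transpose a b ` A))"
    using sum.reindex_bij_betw[of prod.swap S S'
      "\<lambda>(a, b). F A - F (Transposition.transpose a b ` A)"] by (simp add: case_prod_beta)
  hence 2: "(\<Sum>(a, b)\<in>S'. F A - F (Transposition.transpose a b ` A)) =
      (\<Sum>(a, b)\<in>S. F A - F (Transposition.transpose a b ` A))"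
    by (simp add: transpose_commute)
  \<comment> \<open>If \<open>a\<close> and \<open>b\<close> lie both inside or both outside
    \<open>A\<close>, the transposition maps \<open>A\<close> to itself.\<close>
  have "(\<Sum>(a, b)\<in>parcs G. F A - F (Transposition.transpose a b ` A)) =
      (\<Sum>(a, b)\<in>S \<union> S'. F A - F (Transposition.transpose a b ` A))"
    by (rule sum.mono_neutral_right) (auto simp: S_def S'_def intro: ccontr)
  also have "\<dots> = (\<Sum>(a, b)\<in>S. F A - F (Transposition.transpose a b ` A)) +
      (\<Sum>(a, b)\<in>S'. F A - F (Transposition.transpose a b ` A))"
    by (rule sum.union_disjoint)
      (auto simp: S_def S'_def intro: finite_subset[OF _ finite_arcs[unfolded with_proj_simps]])
  finally show ?thesis
    using 1 2 by simp
qed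

section \<open>Linearly independent families and kernels\<close>

text \<open>With the vectors as columns of \<open>M\<close>, a relation among the images is a
  nonzero \<open>x\<close> with \<open>(A * M) *\<^sub>v x = 0\<close>, and injectivity gives
  \<open>M *\<^sub>v x = 0\<close>. It will be applied to \<open>B\<close> and to the product of its
  transpose with \<open>B\<close>.\<close>

lemma lin_indpt_family_mult_mat_vec:
  assumes A: "A \<in> carrier_mat nr nc"
    and inj: "\<And>v. v \<in> carrier_vec nc \<Longrightarrow> A *\<^sub>v v = 0\<^sub>v nr \<Longrightarrow> v = 0\<^sub>v nc"
    and vs: "lin_indpt_family nc vs"
  shows "lin_indpt_family nr (map (\<lambda>v. A *\<^sub>v v) vs)"
proof -
  interpret C: vec_space "TYPE(real)" nc .
  interpret R: vec_space "TYPE(real)" nr .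
  have vs_carrier: "set vs \<subseteq> carrier_vec nc" and dist: "distinct vs" and indpt: "C.lin_indpt (set vs)"
    using vs unfolding lin_indpt_family_def by auto
  have inj_on: "inj_on (\<lambda>v. A *\<^sub>v v) (set vs)"
  proof (rule inj_onI)
    fix v w assume vw: "v \<in> set vs" "w \<in> set vs" "A *\<^sub>v v = A *\<^sub>v w"
    have v: "v \<in> carrier_vec nc" and w: "w \<in> carrier_vec nc"
      using vw vs_carrier by auto
    have "A *\<^sub>v (v - w) = 0\<^sub>v nr"
      using mult_minus_distrib_mat_vec[OF A v w] vw(3) A w by simp
    hence "v - w = 0\<^sub>v nc"
      using v w by (intro inj) auto
    hence "(v - w) $ i = 0" if "i < nc" for i
      using that by simp
    thus "v = w"
      using v w by (intro eq_vecI) auto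
  qed
  have dist': "distinct (map (\<lambda>v. A *\<^sub>v v) vs)"
    using dist inj_on by (simp add: distinct_map)
  define M where "M = mat_of_cols nc vs"
  have M: "M \<in> carrier_mat nc (length vs)"
    unfolding M_def by simp
  have cols_M: "cols M = vs"
    unfolding M_def using vs_carrier by (rule cols_mat_of_cols)
  have "cols (A * M) = map (\<lambda>v. A *\<^sub>v v) (cols M)"
    using A M by (intro nth_equalityI) auto
  hence cols_AM: "cols (A * M) = map (\<lambda>v. A *\<^sub>v v) vs"
    unfolding cols_M .
  have "R.lin_indpt (set (map (\<lambda>v. A *\<^sub>v v) vs))"
  proof
    assume "R.lin_dep (set (map (\<lambda>v. A *\<^sub>v v) vs))"
    then obtain x where x: "x \<in> carrier_vec (length vs)" "x \<noteq> 0\<^sub>v (length vs)" "(A * M) *\<^sub>v x = 0\<^sub>v nr"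
      using R.lin_depE[of "A * M" "length vs"] A M dist' unfolding cols_AM by auto
    have "M *\<^sub>v x = 0\<^sub>v nc"
      using x A M by (intro inj) (auto simp: assoc_mult_mat_vec)
    hence "C.lin_dep (set vs)"
      using C.lin_depI[OF M x(1,2)] dist by (simp add: cols_M)
    thus False using indpt by simp
  qed
  thus ?thesis
    using dist' A vs_carrier unfolding lin_indpt_family_def by auto
qed

text \<open>Bounds geometric multiplicities from below when applied to a characteristic
  matrix.\<close>

lemma length_le_kernel_dim:
  assumes A: "A \<in> carrier_mat nr nc" and vs: "lin_indpt_family nc vs" "set vs \<subseteq> mat_kernel A"
  shows "length vs \<le> kernel_dim A"
proof -
  interpret kernel nr nc A by unfold_locales fact
  obtain B where "finite B" "basis B"
    using kernel_basis_exists[OF A] by auto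
  hence "Ker.fin_dim"
    unfolding Ker.fin_dim_def Ker.basis_def by auto
  \<comment> \<open>Independence in the kernel as a space of its own agrees with independence in the
    ambient space.\<close>
  moreover have "lin_indpt (set vs)"
    using vs unfolding lin_indpt_family_def by (simp add: lindep_same)
  ultimately have "card (set vs) \<le> dim"
    using vs(2) by (intro Ker.li_le_dim(2)) auto
  thus ?thesis
    using vs(1) by (simp add: lin_indpt_family_def distinct_card)
qed

lemma kernel_family_exists:
  fixes A :: "real mat"
  assumes A: "A \<in> carrier_mat nr nc"
  obtains vs where "length vs = kernel_dim A" "lin_indpt_family nc vs" "set vs \<subseteq> mat_kernel A"
proof -
  interpret kernel nr nc A by unfold_locales fact
  obtain B where B: "finite B" "basis B"
    using kernel_basis_exists[OF A] by auto
  obtain vs where vs: "set vs = B" "distinct vs"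
    using finite_distinct_list[OF B(1)] by auto
  have "B \<subseteq> mat_kernel A" "lin_indpt B"
    using B(2) unfolding Ker.basis_def by auto
  moreover have "length vs = kernel_dim A"
    using vs Ker.dim_basis[OF B] by (simp flip: distinct_card)
  ultimately show thesis
    using vs mat_kernel_carrier[OF A] by (intro that[of vs]) (auto simp: lin_indpt_family_def lindep_same)
qed

lemma lin_indpt_family_nonzero:
  assumes "lin_indpt_family d vs" "v \<in> set vs"
  shows "v \<noteq> 0\<^sub>v d"
proof -
  interpret vec_space "TYPE(real)" d .
  show ?thesis
    using assms vs_zero_lin_dep[of "set vs"] unfolding lin_indpt_family_def by auto
qed

section \<open>Symmetric real matrices: algebraic equals geometric multiplicity\<close>

lemma eigenvector_iff_mat_kernel:
  assumes "A \<in> carrier_mat n n"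
  shows "eigenvector A v l \<longleftrightarrow> v \<in> mat_kernel (char_matrix A l) \<and> v \<noteq> 0\<^sub>v n"
  unfolding eigenvector_char_matrix[OF assms] mat_kernel[OF char_matrix_closed[OF assms]] by auto

text \<open>If \<open>C\<close> kills \<open>C v\<close>, then symmetry gives \<open>C v\<close>
  squared length 0. Hence generalized eigenspaces of a symmetric matrix are eigenspaces.\<close>

lemma symmetric_mat_kernel_pow:
  fixes C :: "real mat"
  assumes C: "C \<in> carrier_mat n n" and sym: "transpose_mat C = C" and "0 < m"
  shows "mat_kernel (C ^\<^sub>m m) = mat_kernel C"
proof -
  have Cm: "C ^\<^sub>m m \<in> carrier_mat n n" for m
    using C by simp
  have kernel_sq: "C *\<^sub>v v = 0\<^sub>v n" if v: "v \<in> carrier_vec n" and "C *\<^sub>v (C *\<^sub>v v) = 0\<^sub>v n" for v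
  proof -
    have "(C *\<^sub>v v) \<bullet> (C *\<^sub>v v) = (C *\<^sub>v (C *\<^sub>v v)) \<bullet> v"
      using transpose_vec_mult_scalar[OF C v, of "C *\<^sub>v v"] C v by (simp add: sym)
    \<comment> \<open>Over the reals \<open>\<bullet>c\<close> agrees with \<open>\<bullet>\<close>,
      so its definiteness applies.\<close>
    hence "(C *\<^sub>v v) \<bullet>c (C *\<^sub>v v) = 0"
      using that by simp
    thus ?thesis
      using conjugate_square_eq_0_vec[of "C *\<^sub>v v" n] C v by simp
  qed
  have "C ^\<^sub>m Suc m *\<^sub>v v = 0\<^sub>v n \<longleftrightarrow> C *\<^sub>v v = 0\<^sub>v n" if v: "v \<in> carrier_vec n" for v m
    using v
  proof (induction m arbitrary: v)
    case 0
    thus ?case using C by simp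
  next
    case (Suc m)
    have "C ^\<^sub>m Suc (Suc m) *\<^sub>v v = C ^\<^sub>m Suc m *\<^sub>v (C *\<^sub>v v)"
      using assoc_mult_mat_vec[OF Cm C Suc.prems, of "Suc m"] by simp
    also have "\<dots> = 0\<^sub>v n \<longleftrightarrow> C *\<^sub>v (C *\<^sub>v v) = 0\<^sub>v n"
      using C Suc.prems by (intro Suc.IH) auto
    also have "\<dots> \<longleftrightarrow> C *\<^sub>v v = 0\<^sub>v n"
      using kernel_sq[OF Suc.prems] C by auto
    finally show ?case .
  qed
  from this[of _ "m - 1"] show ?thesis
    unfolding mat_kernel[OF Cm] mat_kernel[OF C] using \<open>0 < m\<close> by auto
qed

text \<open>The complex eigenvalues are real by the Hermitian argument, so the complex factorization
  descends to the reals. Splitting gives access to a real Jordan normal form.\<close>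

lemma symmetric_char_poly_splits:
  fixes A :: "real mat"
  assumes A: "A \<in> carrier_mat n n" and sym: "transpose_mat A = A"
  obtains as where "char_poly A = (\<Prod>a\<leftarrow>as. [:- a, 1:])"
proof -
  let ?h = "complex_of_real"
  interpret P: map_poly_inj_idom_hom ?h ..
  define C where "C = map_mat ?h A"
  have C: "C \<in> carrier_mat n n" using A unfolding C_def by simp
  have C_transpose: "transpose_mat C = C"
    unfolding C_def by (metis sym map_mat_transpose)
  obtain zs where zs: "char_poly C = (\<Prod>z\<leftarrow>zs. [:- z, 1:])"
    using char_poly_factorized[OF C] by auto
  have real: "z = ?h (Re z)" if "z \<in> set zs" for z
  proof -
    have "poly (char_poly C) z = 0"
      unfolding zs using that by (simp add: poly_prod_list prod_list_zero_iff image_iff)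
    then obtain v where "eigenvector C v z"
      using eigenvalue_root_char_poly[OF C] unfolding eigenvalue_def by auto
    hence v: "v \<in> carrier_vec n" "v \<noteq> 0\<^sub>v n" "C *\<^sub>v v = z \<cdot>\<^sub>v v"
      using C unfolding eigenvector_def by auto
    have conj_mult: "conjugate (C *\<^sub>v v) = C *\<^sub>v conjugate v"
      using A v(1) unfolding C_def
      by (intro eq_vecI) (auto simp: scalar_prod_def conjugate_complex_def)
    \<comment> \<open>Symmetry moves \<open>C\<close> to the other factor, where \<open>z\<close>
      comes out conjugated; \<open>v \<bullet>c v\<close> is nonzero and cancels.\<close>
    have "z * (v \<bullet>c v) = (C *\<^sub>v v) \<bullet>c v"
      using v by simp
    also have "\<dots> = v \<bullet> (C *\<^sub>v conjugate v)"
      using transpose_vec_mult_scalar[OF C, of "conjugate v" v] v(1) C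
      by (simp add: C_transpose comm_scalar_prod[of _ n])
    also have "\<dots> = cnj z * (v \<bullet>c v)"
      unfolding conj_mult[symmetric] v(3) using v(1)
      by (simp add: conjugate_smult_vec conjugate_complex_def)
    finally have "z = cnj z"
      using v(1,2) by (simp add: conjugate_square_eq_0_vec)
    thus ?thesis
      by (simp add: complex_eq_iff)
  qed
  \<comment> \<open>The factorization can be pulled back because \<open>map_poly ?h\<close> is
    injective.\<close>
  have "map_poly ?h (char_poly A) = char_poly C"
    unfolding C_def by (simp add: of_real_hom.char_poly_hom[OF A])
  also have "\<dots> = (\<Prod>z\<leftarrow>zs. map_poly ?h [:- Re z, 1:])"
    unfolding zs using real by (intro arg_cong[of _ _ prod_list] map_cong) auto
  also have "\<dots> = map_poly ?h (\<Prod>z\<leftarrow>zs. [:- Re z, 1:])"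
    by (simp only: P.hom_prod_list map_map comp_def)
  finally have "char_poly A = (\<Prod>z\<leftarrow>zs. [:- Re z, 1:])"
    by simp
  thus thesis
    using that[of "map Re zs"] by (simp add: comp_def)
qed

text \<open>The order is the total size of the Jordan blocks for \<open>l\<close>, which is the
  dimension of a generalized eigenspace of large exponent; by symmetry that space is the
  eigenspace.\<close>

lemma symmetric_order_char_poly:
  fixes A :: "real mat"
  assumes A: "A \<in> carrier_mat n n" and sym: "transpose_mat A = A"
  shows "Polynomial.order l (char_poly A) = kernel_dim (char_matrix A l)"
proof -
  define C where "C = char_matrix A l"
  have C: "C \<in> carrier_mat n n" unfolding C_def using A by simp
  have C_transpose: "transpose_mat C = C"
  proof (rule eq_matI)
    fix i j assume "i < dim_row C" "j < dim_col C"
    hence ij: "i < n" "j < n" using C by auto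
    have "A $$ (j, i) = A $$ (i, j)"
      using A ij index_transpose_mat(1)[of i A j] unfolding sym by simp
    thus "transpose_mat C $$ (i, j) = C $$ (i, j)"
      using A ij unfolding C_def char_matrix_def by simp
  qed (use C in auto)
  obtain as where "char_poly A = (\<Prod>a\<leftarrow>as. [:- a, 1:])"
    using symmetric_char_poly_splits[OF A sym] .
  then obtain n_as where jnf: "jordan_nf A n_as"
    using jordan_nf_exists[OF A] by blast
  define ns where "ns = map fst (filter (\<lambda>na. snd na = l) n_as)"
  \<comment> \<open>This exponent is at least every block size, so \<open>min m\<close> truncates
    nothing; \<open>Suc\<close> keeps it positive even if \<open>l\<close> has no block.\<close>
  define m where "m = Suc (sum_list ns)"
  have "Polynomial.order l (char_poly A) = sum_list ns"
    unfolding ns_def by (rule jordan_nf_order[OF jnf])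
  also have "\<dots> = sum_list (map (min m) ns)"
  proof -
    have "map (min m) ns = ns"
      unfolding m_def by (intro map_idI) (auto intro!: min_absorb2 le_SucI member_le_sum_list)
    thus ?thesis by simp
  qed
  also have "\<dots> = dim_gen_eigenspace A l m"
    unfolding dim_gen_eigenspace[OF jnf] ns_def by (simp add: case_prod_unfold)
  also have "\<dots> = kernel_dim (C ^\<^sub>m m)"
    unfolding dim_gen_eigenspace_def C_def ..
  also have "\<dots> = kernel_dim C"
    using symmetric_mat_kernel_pow[OF C C_transpose, of m] C unfolding kernel_dim_def m_def by simp
  finally show ?thesis unfolding C_def .
qed

section \<open>Laplacian and binomial matrices\<close>

lemma sum_nth_is_ordering:
  assumes "is_ordering xs S"
  shows "(\<Sum>j<length xs. f (xs ! j)) = sum f S"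
  using assms sum.reindex_bij_betw[OF bij_betw_nth[of xs "{..<length xs}" S], of f]
  unfolding is_ordering_def by simp

lemma laplacian_matrix_carrier: "laplacian_matrix xs G \<in> carrier_mat (length xs) (length xs)"
  unfolding laplacian_matrix_def adjacency_matrix_def degree_matrix_def by auto

lemma laplacian_matrix_symmetric:
  assumes "pair_graph G"
  shows "transpose_mat (laplacian_matrix xs G) = laplacian_matrix xs G"
proof -
  interpret pair_graph G by fact
  have "(b, a) \<in> parcs G \<longleftrightarrow> (a, b) \<in> parcs G" for a b
    using sym_arcs by (auto simp: symmetric_def dest: symD)
  thus ?thesis
    unfolding laplacian_matrix_def adjacency_matrix_def degree_matrix_def
    by (intro eq_matI) auto
qed

text \<open>The vector comes from a function \<open>F\<close> on sets, so that the transposed sets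
  need not be located in the ordering.\<close>

lemma token_laplacian_mult_vec:
  assumes G: "pair_graph G" and xs: "is_ordering xs (k_subsets (pverts G) k)" and i: "i < length xs"
  shows "(laplacian_matrix xs (token_graph k G) *\<^sub>v vec (length xs) (\<lambda>j. F (xs ! j))) $ i =
    (\<Sum>(a, b)\<in>parcs G. F (xs ! i) - F (Transposition.transpose a b ` (xs ! i))) / 2"
proof -
  let ?T = "token_graph k G"
  let ?d = "real (out_degree (with_proj ?T) (xs ! i))"
  let ?adj = "\<lambda>B. if (xs ! i, B) \<in> parcs ?T then F B else 0"
  have "(laplacian_matrix xs ?T *\<^sub>v vec (length xs) (\<lambda>j. F (xs ! j))) $ i =
      (\<Sum>j<length xs. laplacian_matrix xs ?T $$ (i, j) * F (xs ! j))"
    using i laplacian_matrix_carrier[of xs ?T]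
    by (auto simp: scalar_prod_def atLeast0LessThan intro!: sum.cong)
  also have "\<dots> = (\<Sum>j<length xs. (if i = j then ?d * F (xs ! i) else 0) - ?adj (xs ! j))"
    using i unfolding laplacian_matrix_def adjacency_matrix_def degree_matrix_def
    by (intro sum.cong) (auto simp: left_diff_distrib)
  also have "\<dots> = ?d * F (xs ! i) - (\<Sum>j<length xs. ?adj (xs ! j))"
    using i by (simp add: sum_subtractf)
  also have "(\<Sum>j<length xs. ?adj (xs ! j)) = sum ?adj (k_subsets (pverts G) k)"
    by (rule sum_nth_is_ordering[OF xs])
  also have "?d * F (xs ! i) - sum ?adj (k_subsets (pverts G) k) =
      (\<Sum>(a, b)\<in>parcs G. F (xs ! i) - F (Transposition.transpose a b ` (xs ! i))) / 2"
    using xs i unfolding is_ordering_def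
    by (intro token_laplacian_eq_sum_transpositions[OF G]) auto
  finally show ?thesis .
qed

lemma binomial_matrix_carrier: "binomial_matrix xs ys \<in> carrier_mat (length xs) (length ys)"
  unfolding binomial_matrix_def by simp

text \<open>A transposition is its own inverse, so its action can be moved across an
  inclusion.\<close>

lemma transpose_image_subset_iff:
  "Transposition.transpose a b ` X \<subseteq> A \<longleftrightarrow> X \<subseteq> Transposition.transpose a b ` A"
  by (auto simp: in_transpose_image_iff image_subset_iff subset_iff)

text \<open>Both products have entries that sum, over the arcs, the change of the inclusion
  indicator: on the left the transposition acts on the \<open>k\<close>-set, on the right on the
  \<open>h\<close>-set.\<close>

lemma binomial_matrix_intertwines:
  assumes G: "pair_graph G"
    and ks: "is_ordering ks (k_subsets (pverts G) k)" and hs: "is_ordering hs (k_subsets (pverts G) h)"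
  shows "laplacian_matrix ks (token_graph k G) * binomial_matrix ks hs =
    binomial_matrix ks hs * laplacian_matrix hs (token_graph h G)"
    (is "?Lk * ?B = ?B * ?Lh")
proof (rule eq_matI)
  note carrier = laplacian_matrix_carrier[of ks "token_graph k G"]
    laplacian_matrix_carrier[of hs "token_graph h G"] binomial_matrix_carrier[of ks hs]
  fix i j assume "i < dim_row (?B * ?Lh)" "j < dim_col (?B * ?Lh)"
  hence i: "i < length ks" and j: "j < length hs" using carrier by auto
  let ?F = "\<lambda>X A. if X \<subseteq> A then 1 else 0 :: real"
  have col: "col ?B j = vec (length ks) (\<lambda>l. ?F (hs ! j) (ks ! l))"
    and row: "row ?B i = vec (length hs) (\<lambda>l. ?F (hs ! l) (ks ! i))"
    using i j unfolding binomial_matrix_def by (auto intro!: eq_vecI)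
  have "(?Lk * ?B) $$ (i, j) = (?Lk *\<^sub>v col ?B j) $ i"
    using i j carrier by auto
  also have "\<dots> = (\<Sum>(a, b)\<in>parcs G.
      ?F (hs ! j) (ks ! i) - ?F (hs ! j) (Transposition.transpose a b ` (ks ! i))) / 2"
    unfolding col by (rule token_laplacian_mult_vec[OF G ks i])
  also have "\<dots> = (\<Sum>(a, b)\<in>parcs G.
      ?F (hs ! j) (ks ! i) - ?F (Transposition.transpose a b ` (hs ! j)) (ks ! i)) / 2"
    by (simp only: transpose_image_subset_iff)
  also have "\<dots> = (?Lh *\<^sub>v row ?B i) $ j"
    unfolding row by (rule token_laplacian_mult_vec[OF G hs j, symmetric])
  \<comment> \<open>An entry of \<open>?B * ?Lh\<close> pairs a row of \<open>?B\<close> with a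
    column of \<open>?Lh\<close>; symmetry makes that column a row.\<close>
  also have "\<dots> = (transpose_mat ?Lh *\<^sub>v row ?B i) $ j"
    by (simp only: laplacian_matrix_symmetric[OF pair_graph_token_graph[OF G]])
  also have "\<dots> = (?B * ?Lh) $$ (i, j)"
    using i j carrier by (auto intro: comm_scalar_prod[of _ "length hs"])
  finally show "(?Lk * ?B) $$ (i, j) = (?B * ?Lh) $$ (i, j)" .
qed (use laplacian_matrix_carrier[of ks "token_graph k G"]
    laplacian_matrix_carrier[of hs "token_graph h G"] binomial_matrix_carrier[of ks hs] in auto)

lemma binomial_matrix_injective:
  assumes V: "finite V" and "h \<le> k" "h + k \<le> card V"
    and ks: "is_ordering ks (k_subsets V k)" and hs: "is_ordering hs (k_subsets V h)"
    and v: "v \<in> carrier_vec (length hs)" and zero: "binomial_matrix ks hs *\<^sub>v v = 0\<^sub>v (length ks)"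
  shows "v = 0\<^sub>v (length hs)"
proof -
  \<comment> \<open>This is \<open>v\<close> indexed by sets instead of positions, which is
    consistent since \<open>hs\<close> is distinct.\<close>
  define f where "f X = v $ inv_into {..<length hs} ((!) hs) X" for X
  have "inj_on ((!) hs) {..<length hs}"
    using hs unfolding is_ordering_def by (simp add: inj_on_nth)
  hence f: "f (hs ! j) = v $ j" if "j < length hs" for j
    using that unfolding f_def by simp
  have "(\<Sum>X\<in>k_subsets A h. f X) = 0" if A: "A \<in> k_subsets V k" for A
  proof -
    obtain i where i: "i < length ks" "ks ! i = A"
      using A ks unfolding is_ordering_def by (metis in_set_conv_nth)
    have "k_subsets A h = {X \<in> k_subsets V h. X \<subseteq> A}"
      using A unfolding k_subsets_def by auto
    hence "(\<Sum>X\<in>k_subsets A h. f X) = (\<Sum>X\<in>k_subsets V h. if X \<subseteq> A then f X else 0)"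
      using V by (simp add: sum.inter_filter finite_k_subsets)
    also have "\<dots> = (\<Sum>j<length hs. if hs ! j \<subseteq> A then f (hs ! j) else 0)"
      by (rule sum_nth_is_ordering[OF hs, symmetric])
    also have "\<dots> = (binomial_matrix ks hs *\<^sub>v v) $ i"
      using i v unfolding binomial_matrix_def
      by (auto simp: scalar_prod_def atLeast0LessThan f intro!: sum.cong)
    finally show ?thesis
      using zero i by simp
  qed
  hence "f X = 0" if "X \<in> k_subsets V h" for X
    using subset_sums_injective[OF V assms(2,3) _ that] by blast
  hence "v $ j = 0" if "j < length hs" for j
    using that hs f unfolding is_ordering_def by (metis nth_mem)
  thus ?thesis
    using v by (intro eq_vecI) auto
qed

section \<open>Transfer of eigenvectors\<close>

text \<open>The general form serves both directions, \<open>B\<close> from \<open>Lh\<close> to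
  \<open>Lk\<close> and its transpose from \<open>Lk\<close> to \<open>Lh\<close>.\<close>

lemma eigenvector_intertwined:
  fixes M N B :: "'a :: field mat"
  assumes M: "M \<in> carrier_mat m m" and N: "N \<in> carrier_mat n n" and B: "B \<in> carrier_mat m n"
    and MB: "M * B = B * N"
    and v: "eigenvector N v l" and nz: "B *\<^sub>v v \<noteq> 0\<^sub>v m"
  shows "eigenvector M (B *\<^sub>v v) l"
proof -
  have v: "v \<in> carrier_vec n" "N *\<^sub>v v = l \<cdot>\<^sub>v v"
    using v N unfolding eigenvector_def by auto
  have "M *\<^sub>v (B *\<^sub>v v) = B *\<^sub>v (N *\<^sub>v v)"
    using M N B v(1) MB by (metis assoc_mult_mat_vec)
  also have "\<dots> = l \<cdot>\<^sub>v (B *\<^sub>v v)"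
    unfolding v(2) using B v(1) by (rule mult_mat_vec)
  finally show ?thesis
    using M B v(1) nz unfolding eigenvector_def by auto
qed

text \<open>The squared length of \<open>B v\<close> is the scalar product of
  \<open>transpose_mat B * B\<close> applied to \<open>v\<close> with \<open>v\<close>.\<close>

lemma transpose_mult_injective:
  fixes B :: "real mat"
  assumes B: "B \<in> carrier_mat m n"
    and inj: "\<And>v. v \<in> carrier_vec n \<Longrightarrow> B *\<^sub>v v = 0\<^sub>v m \<Longrightarrow> v = 0\<^sub>v n"
    and v: "v \<in> carrier_vec n" and zero: "(transpose_mat B * B) *\<^sub>v v = 0\<^sub>v n"
  shows "v = 0\<^sub>v n"
proof -
  have Bv: "B *\<^sub>v v \<in> carrier_vec m" using B v by simp
  have "(B *\<^sub>v v) \<bullet> (B *\<^sub>v v) = (transpose_mat B *\<^sub>v (B *\<^sub>v v)) \<bullet> v"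
    using transpose_vec_mult_scalar[OF B v Bv] by simp
  also have "transpose_mat B *\<^sub>v (B *\<^sub>v v) = 0\<^sub>v n"
    using assoc_mult_mat_vec[of "transpose_mat B" n m B n v] B v zero by simp
  finally have "(B *\<^sub>v v) \<bullet> (B *\<^sub>v v) = 0"
    using v by simp
  hence "B *\<^sub>v v = 0\<^sub>v m"
    using conjugate_square_eq_0_vec[of "B *\<^sub>v v" m] Bv by simp
  thus ?thesis using v by (intro inj)
qed

text \<open>Multiplicities are stated algebraically, by roots of characteristic polynomials;
  \<open>symmetric_order_char_poly\<close> makes them dimensions of eigenspaces.\<close>

theorem corollary4p5:
  fixes G :: "nat pair_pre_digraph" and n h k :: nat
    and hs ks :: "nat set list" and B Lh Lk :: "real mat"
  assumes "pair_graph G" and "pverts G = {1..n}"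
    and "1 \<le> h" and "h \<le> k" and "real k \<le> real n / 2"
    and "is_ordering hs (k_subsets {1..n} h)" and "is_ordering ks (k_subsets {1..n} k)"
    and "B = binomial_matrix ks hs"
    and "Lh = laplacian_matrix hs (token_graph h G)"
    and "Lk = laplacian_matrix ks (token_graph k G)"
  shows
    "((\<forall>l v. eigenvector Lh v l \<longrightarrow> eigenvector Lk (B *\<^sub>v v) l) \<and>
      (\<forall>vs. (\<forall>v\<in>set vs. \<exists>l. eigenvector Lh v l) \<and> lin_indpt_family (n choose h) vs \<longrightarrow>
         lin_indpt_family (n choose k) (map (\<lambda>v. B *\<^sub>v v) vs)) \<and>
      proots (char_poly Lh) \<subseteq># proots (char_poly Lk)) \<and>
     ((\<forall>l w. eigenvector Lk w l \<and> transpose_mat B *\<^sub>v w \<noteq> 0\<^sub>v (n choose h) \<longrightarrow>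
         eigenvector Lh (transpose_mat B *\<^sub>v w) l) \<and>
      (\<forall>l m. eigenvalue Lh l \<and> m = Polynomial.order l (char_poly Lh) \<longrightarrow>
         (\<exists>ws. length ws = m \<and> (\<forall>w\<in>set ws. eigenvector Lk w l) \<and>
            lin_indpt_family (n choose h) (map (\<lambda>w. transpose_mat B *\<^sub>v w) ws))))"
proof -
  let ?H = "n choose h" and ?K = "n choose k"
  have len: "length hs = ?H" "length ks = ?K"
    using assms(6,7) card_k_subsets[of "{1..n}"] unfolding is_ordering_def
    by (metis distinct_card finite_atLeastAtMost card_atLeastAtMost diff_Suc_1)+
  have Lh: "Lh \<in> carrier_mat ?H ?H" and Lk: "Lk \<in> carrier_mat ?K ?K" and B: "B \<in> carrier_mat ?K ?H"
    using laplacian_matrix_carrier binomial_matrix_carrier len unfolding assms(8-10) by metis+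
  have BT: "transpose_mat B \<in> carrier_mat ?H ?K" using B by simp
  have sym: "transpose_mat Lh = Lh" "transpose_mat Lk = Lk"
    unfolding assms(9,10) by (intro laplacian_matrix_symmetric pair_graph_token_graph assms(1))+
  have LB: "Lk * B = B * Lh"
    unfolding assms(8-10) using assms(1,2,6,7) by (intro binomial_matrix_intertwines) auto
  have LBT: "Lh * transpose_mat B = transpose_mat B * Lk"
    using arg_cong[OF LB, of transpose_mat] B Lh Lk by (simp add: transpose_mult sym)
  \<comment> \<open>From \<open>h \<le> k\<close> and \<open>2 k \<le> n\<close>; this is the size
    condition for injectivity of \<open>B\<close>.\<close>
  have hk: "h + k \<le> card {1..n}"
    using assms(4,5) by simp
  have inj: "v = 0\<^sub>v ?H" if "v \<in> carrier_vec ?H" "B *\<^sub>v v = 0\<^sub>v ?K" for v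
    using binomial_matrix_injective[OF _ assms(4) hk assms(7,6), of v] that
    unfolding assms(8) len by simp
  have eigen: "eigenvector Lk (B *\<^sub>v v) l" if v: "eigenvector Lh v l" for v l
    using v inj[of v] Lh
    by (intro eigenvector_intertwined[OF Lk Lh B LB v]) (auto simp: eigenvector_def)
  have indpt: "lin_indpt_family ?K (map (\<lambda>v. B *\<^sub>v v) vs)" if "lin_indpt_family ?H vs" for vs
    using lin_indpt_family_mult_mat_vec[OF B inj that] .
  \<comment> \<open>A basis of the \<open>l\<close>-eigenspace of \<open>Lh\<close>; it yields both
    the inclusion of spectra and the witnesses of part (ii).\<close>
  have eigen_list: "\<exists>vs. length vs = Polynomial.order l (char_poly Lh) \<and>
      (\<forall>v\<in>set vs. eigenvector Lh v l) \<and> lin_indpt_family ?H vs" for l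
  proof -
    obtain vs where vs: "length vs = kernel_dim (char_matrix Lh l)" "lin_indpt_family ?H vs"
        "set vs \<subseteq> mat_kernel (char_matrix Lh l)"
      using kernel_family_exists[OF char_matrix_closed[OF Lh]] .
    moreover have "\<forall>v\<in>set vs. eigenvector Lh v l"
      using vs lin_indpt_family_nonzero[OF vs(2)] unfolding eigenvector_iff_mat_kernel[OF Lh] by auto
    ultimately show ?thesis
      using symmetric_order_char_poly[OF Lh sym(1)] by auto
  qed
  have "proots (char_poly Lh) \<subseteq># proots (char_poly Lk)"
  proof (rule mset_subset_eqI)
    fix l
    obtain vs where vs: "length vs = Polynomial.order l (char_poly Lh)"
        "\<forall>v\<in>set vs. eigenvector Lh v l" "lin_indpt_family ?H vs"
      using eigen_list by blast
    have "length (map (\<lambda>v. B *\<^sub>v v) vs) \<le> kernel_dim (char_matrix Lk l)"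
      using vs(2) eigen eigenvector_iff_mat_kernel[OF Lk]
      by (intro length_le_kernel_dim[OF char_matrix_closed[OF Lk] indpt[OF vs(3)]]) auto
    hence "Polynomial.order l (char_poly Lh) \<le> Polynomial.order l (char_poly Lk)"
      using vs(1) symmetric_order_char_poly[OF Lk sym(2)] by simp
    \<comment> \<open>Counts in \<open>proots\<close> are root orders for nonzero
      polynomials.\<close>
    moreover have "char_poly Lh \<noteq> 0" "char_poly Lk \<noteq> 0"
      using degree_monic_char_poly[OF Lh] degree_monic_char_poly[OF Lk] by auto
    ultimately show "count (proots (char_poly Lh)) l \<le> count (proots (char_poly Lk)) l"
      by simp
  qed
  moreover have "\<exists>ws. length ws = Polynomial.order l (char_poly Lh) \<and> (\<forall>w\<in>set ws. eigenvector Lk w l) \<and>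
      lin_indpt_family ?H (map (\<lambda>w. transpose_mat B *\<^sub>v w) ws)" for l
  proof -
    obtain vs where vs: "length vs = Polynomial.order l (char_poly Lh)"
        "\<forall>v\<in>set vs. eigenvector Lh v l" "lin_indpt_family ?H vs"
      using eigen_list by blast
    \<comment> \<open>The witnesses are the vectors \<open>B v\<close>, whose images under the
      transpose are these.\<close>
    have "lin_indpt_family ?H (map (\<lambda>v. (transpose_mat B * B) *\<^sub>v v) vs)"
      using B transpose_mult_injective[OF B inj]
      by (intro lin_indpt_family_mult_mat_vec[OF _ _ vs(3)]) auto
    moreover have "map (\<lambda>v. (transpose_mat B * B) *\<^sub>v v) vs =
        map (\<lambda>w. transpose_mat B *\<^sub>v w) (map (\<lambda>v. B *\<^sub>v v) vs)"
      using vs(3) assoc_mult_mat_vec[OF BT B] unfolding lin_indpt_family_def by auto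
    ultimately show ?thesis
      using vs eigen by (intro exI[of _ "map (\<lambda>v. B *\<^sub>v v) vs"]) auto
  qed
  ultimately show ?thesis
    using eigen indpt eigenvector_intertwined[OF Lh Lk BT LBT] by blast
qed

end
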